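(* Let $(\mathcal{A},\cdot)$ be a commutative associative algebra over $\mathbb{C}$ and let $d$ be a derivation of $\mathcal{A}$. Let $\tilde{\mathcal{A}}=\mathcal{A}\times\mathcal{A}=\tilde{\mathcal{A}}_0\oplus\tilde{\mathcal{A}}_1$ with $\tilde{\mathcal{A}}_0=(\mathcal{A},0)$ and $\tilde{\mathcal{A}}_1=(0,\mathcal{A})$. Let $\xi,\eta_0,\eta_1\in\mathcal{A}$ be any three elements satisfying $$2\xi\eta_1=\xi\eta_0+d(\xi),$$ and define for $u_0,u_1,v_0,v_1\in\mathcal{A}$ $$[(u_0,u_1),(v_0,v_1)]=(\xi u_1v_1,0),$$ $$(u_0,u_1)\circ(v_0,v_1)=\big(u_0(d(v_0)+\eta_0v_0),\;u_1(d(v_0)+\eta_0v_0)+u_0(d(v_1)+\eta_1v_1)\big).$$ Then $(\tilde{\mathcal{A}},[\cdot,\cdot],\circ)$ is a super Gel'fand-Dorfman bialgebra.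
   Context: All vector spaces are over $\mathbb{C}$; operations are bilinear and $\mathbb{Z}_2$-graded. A Lie superalgebra $L=L_0\oplus L_1$ satisfies $[u,v]=-(-1)^{ij}[v,u]$ and $[w,[v,u]]=[[w,v],u]-(-1)^{ij}[[w,u],v]$ for $u\in L_i,v\in L_j,w\in L$. A Novikov superalgebra $(\mathcal{B},\circ)$ satisfies $(u\circ v)\circ w=(-1)^{jl}(u\circ w)\circ v$ and $(u,v,w)=(-1)^{ij}(v,u,w)$ for $u\in\mathcal{B}_i,v\in\mathcal{B}_j,w\in\mathcal{B}_l$, where $(u,v,w)=(u\circ v)\circ w-u\circ(v\circ w)$. A super Gel'fand-Dorfman bialgebra $(\mathcal{B},[\cdot,\cdot],\circ)$ is a $\mathbb{Z}_2$-graded space such that $(\mathcal{B},[\cdot,\cdot])$ is a Lie superalgebra, $(\mathcal{B},\circ)$ is a Novikov superalgebra and $$[w\circ u,v]-(-1)^{ij}[w\circ v,u]+[w,u]\circ v-(-1)^{ij}[w,v]\circ u-w\circ[u,v]=0$$ for $u\in\mathcal{B}_i$, $v\in\mathcal{B}_j$, $w\in\mathcal{B}$. *)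

theory Defs
  imports Complex_Main "HOL-Library.Product_Plus" "HOL-Library.Z2"
begin

text \<open>All vector spaces are over the complex numbers, with explicit scalar multiplication.
  Gradings are indexed by the two-element field of type \<^typ>\<open>bit\<close>, so that
  addition of degrees is taken modulo 2.\<close>

locale comm_assoc_algebra = vector_space scale
  for scale :: "complex \<Rightarrow> 'a::comm_ring \<Rightarrow> 'a" +
  assumes scale_mult: "scale c (x * y) = scale c x * y"
  \<comment> \<open>\<^class>\<open>comm_ring\<close> does not demand a unit; linearity in the second factor follows
    from commutativity.\<close>

locale derivation = comm_assoc_algebra scale
  for scale :: "complex \<Rightarrow> 'a::comm_ring \<Rightarrow> 'a" +
  fixes d :: "'a \<Rightarrow> 'a"
  assumes linear: "Vector_Spaces.linear scale scale d"
    and leibniz: "d (x * y) = d x * y + x * d y"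

text \<open>The sign $(-1)^{ij}$.\<close>

definition parity_sign :: "bit \<Rightarrow> bit \<Rightarrow> complex" where
  "parity_sign i j = (if i * j = 1 then - 1 else 1)"

locale super_space = vector_space scale
  for scale :: "complex \<Rightarrow> 'b::ab_group_add \<Rightarrow> 'b" +
  fixes B :: "bit \<Rightarrow> 'b set"
  assumes subspace_component: "subspace (B i)"
    and components_inter: "B 0 \<inter> B 1 = {0}"
    and components_sum: "\<exists>u\<in>B 0. \<exists>v\<in>B 1. x = u + v"

locale graded_operation = super_space scale B
  for scale :: "complex \<Rightarrow> 'b::ab_group_add \<Rightarrow> 'b" and B :: "bit \<Rightarrow> 'b set" +
  fixes m :: "'b \<Rightarrow> 'b \<Rightarrow> 'b"
  assumes linear_left: "Vector_Spaces.linear scale scale (\<lambda>u. m u v)"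
    and linear_right: "Vector_Spaces.linear scale scale (\<lambda>v. m u v)"
    and graded: "u \<in> B i \<Longrightarrow> v \<in> B j \<Longrightarrow> m u v \<in> B (i + j)"

locale lie_superalgebra = graded_operation scale B br
  for scale :: "complex \<Rightarrow> 'b::ab_group_add \<Rightarrow> 'b" and B :: "bit \<Rightarrow> 'b set"
    and br :: "'b \<Rightarrow> 'b \<Rightarrow> 'b" +
  assumes super_skew: "u \<in> B i \<Longrightarrow> v \<in> B j \<Longrightarrow> br u v = - scale (parity_sign i j) (br v u)"
    and super_jacobi: "u \<in> B i \<Longrightarrow> v \<in> B j \<Longrightarrow>
      br w (br v u) = br (br w v) u - scale (parity_sign i j) (br (br w u) v)"

definition associator :: "('b::ab_group_add \<Rightarrow> 'b \<Rightarrow> 'b) \<Rightarrow> 'b \<Rightarrow> 'b \<Rightarrow> 'b \<Rightarrow> 'b" where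
  "associator m u v w = m (m u v) w - m u (m v w)"

locale novikov_superalgebra = graded_operation scale B circ
  for scale :: "complex \<Rightarrow> 'b::ab_group_add \<Rightarrow> 'b" and B :: "bit \<Rightarrow> 'b set"
    and circ :: "'b \<Rightarrow> 'b \<Rightarrow> 'b" +
  assumes right_super_comm: "u \<in> B i \<Longrightarrow> v \<in> B j \<Longrightarrow> w \<in> B l \<Longrightarrow>
      circ (circ u v) w = scale (parity_sign j l) (circ (circ u w) v)"
    and left_super_symm: "u \<in> B i \<Longrightarrow> v \<in> B j \<Longrightarrow> w \<in> B l \<Longrightarrow>
      associator circ u v w = scale (parity_sign i j) (associator circ v u w)"

locale super_gelfand_dorfman_bialgebra =
  lie: lie_superalgebra scale B br + novikov: novikov_superalgebra scale B circ
  for scale :: "complex \<Rightarrow> 'b::ab_group_add \<Rightarrow> 'b" and B :: "bit \<Rightarrow> 'b set"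
    and br :: "'b \<Rightarrow> 'b \<Rightarrow> 'b" and circ :: "'b \<Rightarrow> 'b \<Rightarrow> 'b" +
  assumes compatible: "u \<in> B i \<Longrightarrow> v \<in> B j \<Longrightarrow>
      br (circ w u) v - scale (parity_sign i j) (br (circ w v) u)
        + circ (br w u) v - scale (parity_sign i j) (circ (br w v) u)
        - circ w (br u v) = 0"

definition tilde_scale :: "(complex \<Rightarrow> 'a \<Rightarrow> 'a) \<Rightarrow> complex \<Rightarrow> 'a \<times> 'a \<Rightarrow> 'a \<times> 'a" where
  "tilde_scale scale c = map_prod (scale c) (scale c)"

definition tilde_component :: "bit \<Rightarrow> ('a::zero \<times> 'a) set" where
  "tilde_component i = (if i = 0 then UNIV \<times> {0} else {0} \<times> UNIV)"

fun tilde_bracket :: "'a::comm_ring \<Rightarrow> 'a \<times> 'a \<Rightarrow> 'a \<times> 'a \<Rightarrow> 'a \<times> 'a" where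
  "tilde_bracket \<xi> (u\<^sub>0, u\<^sub>1) (v\<^sub>0, v\<^sub>1) = (\<xi> * u\<^sub>1 * v\<^sub>1, 0)"

fun tilde_circ ::
  "('a::comm_ring \<Rightarrow> 'a) \<Rightarrow> 'a \<Rightarrow> 'a \<Rightarrow> 'a \<times> 'a \<Rightarrow> 'a \<times> 'a \<Rightarrow> 'a \<times> 'a" where
  "tilde_circ d \<eta>\<^sub>0 \<eta>\<^sub>1 (u\<^sub>0, u\<^sub>1) (v\<^sub>0, v\<^sub>1) =
    (u\<^sub>0 * (d v\<^sub>0 + \<eta>\<^sub>0 * v\<^sub>0),
     u\<^sub>1 * (d v\<^sub>0 + \<eta>\<^sub>0 * v\<^sub>0) + u\<^sub>0 * (d v\<^sub>1 + \<eta>\<^sub>1 * v\<^sub>1))"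

end

theory Submission
  imports Defs
begin

text \<open>All double brackets vanish, and on homogeneous elements the remaining identities follow from
  commutativity and the Leibniz rule. The hypothesis on $\xi$ enters only in the compatibility
  identity for odd $u$, $v$ and even $w$, whose left-hand side is
  $(2\xi\eta_1 - \xi\eta_0 - d(\xi))\,u v w$.\<close>

lemma super_space_tilde:
  fixes scale :: "complex \<Rightarrow> 'a::ab_group_add \<Rightarrow> 'a"
  assumes "vector_space scale"
  shows "super_space (tilde_scale scale) tilde_component"
proof -
  interpret vector_space scale by fact
  interpret tilde: vector_space "tilde_scale scale"
    by unfold_locales (auto simp: tilde_scale_def scale_right_distrib scale_left_distrib)
  show ?thesis
  proof
    show "tilde.subspace (tilde_component i)" for i
      by (auto simp: tilde.subspace_def tilde_component_def tilde_scale_def zero_prod_def)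
    show "tilde_component 0 \<inter> tilde_component 1 = {0 :: 'a \<times> 'a}"
      by (auto simp: tilde_component_def zero_prod_def)
    show "\<exists>u\<in>tilde_component 0. \<exists>v\<in>tilde_component 1. x = u + v" for x :: "'a \<times> 'a"
      by (cases x) (auto simp: tilde_component_def)
  qed
qed

context comm_assoc_algebra
begin

text \<open>Together with \<open>scale_mult\<close> read backwards, this pulls scalars to the
  outside, the normal form in which homogeneity of both operations is checked.\<close>

lemma mult_scale_right: "x * scale c y = scale c (x * y)"
  by (metis mult.commute scale_mult)

text \<open>The algebra may lack a unit, so the 2 in the relation on \<xi> is a scalar; written as a
  sum it is open to ring normalisation.\<close>

lemma scale_2: "scale 2 x = x + x"
  by (metis one_add_one scale_left_distrib scale_one)

lemma lie_superalgebra_tilde: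
  "lie_superalgebra (tilde_scale scale) tilde_component (tilde_bracket \<xi>)"
proof -
  interpret tilde: super_space "tilde_scale scale" tilde_component
    by (rule super_space_tilde) unfold_locales
  show ?thesis
  proof
    fix x y z :: "'a \<times> 'a" and c :: complex
    show "tilde_bracket \<xi> (x + y) z = tilde_bracket \<xi> x z + tilde_bracket \<xi> y z"
      "tilde_bracket \<xi> z (x + y) = tilde_bracket \<xi> z x + tilde_bracket \<xi> z y"
      by (cases x; cases y; cases z; simp add: algebra_simps)+
    show "tilde_bracket \<xi> (tilde_scale scale c x) y = tilde_scale scale c (tilde_bracket \<xi> x y)"
      "tilde_bracket \<xi> x (tilde_scale scale c y) = tilde_scale scale c (tilde_bracket \<xi> x y)"
      by (cases x; cases y; simp add: tilde_scale_def mult_scale_right flip: scale_mult)+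
  next
    fix u v w :: "'a \<times> 'a" and i j
    assume uv: "u \<in> tilde_component i" "v \<in> tilde_component j"
    show "tilde_bracket \<xi> u v \<in> tilde_component (i + j)"
      using uv by (cases i; cases j) (auto simp: tilde_component_def)
    \<comment> \<open>Only two odd arguments give a nonzero bracket. There the parity sign cancels
      the outer minus, and the claim is the symmetry of \<xi> * u * v.\<close>
    show "tilde_bracket \<xi> u v
        = - tilde_scale scale (parity_sign i j) (tilde_bracket \<xi> v u)"
      using uv by (cases i; cases j)
        (auto simp: tilde_component_def parity_sign_def tilde_scale_def mult_ac)
    \<comment> \<open>Brackets read only odd coordinates and land in the even part, so each of the
      three terms is zero.\<close>
    show "tilde_bracket \<xi> w (tilde_bracket \<xi> v u) = tilde_bracket \<xi> (tilde_bracket \<xi> w v) u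
        - tilde_scale scale (parity_sign i j) (tilde_bracket \<xi> (tilde_bracket \<xi> w u) v)"
      by (cases u; cases v; cases w) (simp add: tilde_scale_def zero_prod_def)
  qed
qed

end

context derivation
begin

lemma d_add: "d (x + y) = d x + d y"
  and d_scale: "d (scale c x) = scale c (d x)"
  and d_zero: "d 0 = 0"
  using linear by (simp_all add: Vector_Spaces.linear.axioms module_hom.add module_hom.scale
      module_hom.zero linear_iff_module_hom)

text \<open>Put D_k = d + \<eta>_k. For homogeneous a and b the product is a * D_k b, with k the
  degree of b, except that two odd elements multiply to 0. Hence both sides of either identity
  vanish whenever its sign is -1.\<close>

lemma novikov_superalgebra_tilde:
  "novikov_superalgebra (tilde_scale scale) tilde_component (tilde_circ d \<eta>\<^sub>0 \<eta>\<^sub>1)"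
proof -
  interpret tilde: super_space "tilde_scale scale" tilde_component
    by (rule super_space_tilde) unfold_locales
  let ?m = "tilde_circ d \<eta>\<^sub>0 \<eta>\<^sub>1"
  show ?thesis
  proof
    fix x y z :: "'a \<times> 'a" and c :: complex
    show "?m (x + y) z = ?m x z + ?m y z" "?m z (x + y) = ?m z x + ?m z y"
      by (cases x; cases y; cases z; simp add: algebra_simps d_add)+
    show "?m (tilde_scale scale c x) y = tilde_scale scale c (?m x y)"
      "?m x (tilde_scale scale c y) = tilde_scale scale c (?m x y)"
      by (cases x; cases y;
          simp add: tilde_scale_def d_scale mult_scale_right scale_right_distrib distrib_left
            flip: scale_mult)+
  next
    fix u v w :: "'a \<times> 'a" and i j l
    assume uvw: "u \<in> tilde_component i" "v \<in> tilde_component j"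
    show "?m u v \<in> tilde_component (i + j)"
      using uvw by (cases i; cases j) (auto simp: tilde_component_def d_zero)
    assume w: "w \<in> tilde_component l"
    show "?m (?m u v) w = tilde_scale scale (parity_sign j l) (?m (?m u w) v)"
      using uvw w by (cases i; cases j; cases l)
        (auto simp: tilde_component_def parity_sign_def tilde_scale_def d_zero algebra_simps)
    \<comment> \<open>In the nonzero cases with \<open>v\<close> even or odd, Leibniz cancels the
      terms in d v; what remains is u * v times an expression in \<open>w\<close> alone, symmetric
      in \<open>u\<close> and \<open>v\<close>.\<close>
    show "associator ?m u v w = tilde_scale scale (parity_sign i j) (associator ?m v u w)"
      using uvw w by (cases i; cases j; cases l)
        (auto simp: tilde_component_def parity_sign_def tilde_scale_def associator_def zero_prod_def
          d_zero d_add leibniz algebra_simps)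
  qed
qed

text \<open>For even \<open>u\<close> and \<open>v\<close> all terms vanish. If exactly one is odd,
  two terms survive and cancel by commutativity. If both are odd, Leibniz applied to \<xi> * u * v
  in the last term produces d \<xi>, and the terms in d u and d v cancel.\<close>

lemma tilde_compatible:
  assumes rel: "scale 2 (\<xi> * \<eta>\<^sub>1) = \<xi> * \<eta>\<^sub>0 + d \<xi>"
    and u: "u \<in> tilde_component i" and v: "v \<in> tilde_component j"
  shows "tilde_bracket \<xi> (tilde_circ d \<eta>\<^sub>0 \<eta>\<^sub>1 w u) v
      - tilde_scale scale (parity_sign i j) (tilde_bracket \<xi> (tilde_circ d \<eta>\<^sub>0 \<eta>\<^sub>1 w v) u)
      + tilde_circ d \<eta>\<^sub>0 \<eta>\<^sub>1 (tilde_bracket \<xi> w u) v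
      - tilde_scale scale (parity_sign i j) (tilde_circ d \<eta>\<^sub>0 \<eta>\<^sub>1 (tilde_bracket \<xi> w v) u)
      - tilde_circ d \<eta>\<^sub>0 \<eta>\<^sub>1 w (tilde_bracket \<xi> u v) = 0"
proof -
  \<comment> \<open>Solved for d \<xi>, the relation serves as a rewrite rule. For odd
    \<open>u\<close> and \<open>v\<close> it is applied in both coordinates: the odd part of
    \<open>w\<close> leaves the same factor as the even part.\<close>
  have d_xi: "d \<xi> = \<xi> * \<eta>\<^sub>1 + \<xi> * \<eta>\<^sub>1 - \<xi> * \<eta>\<^sub>0"
    using rel by (simp add: scale_2)
  show ?thesis
    using u v by (cases w; cases i; cases j)
      (auto simp: tilde_component_def parity_sign_def tilde_scale_def zero_prod_def
        d_zero leibniz d_xi algebra_simps)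
qed

end

theorem theorem3p3:
  fixes scale :: "complex \<Rightarrow> 'a::comm_ring \<Rightarrow> 'a"
    and d :: "'a \<Rightarrow> 'a"
    and \<xi> \<eta>\<^sub>0 \<eta>\<^sub>1 :: 'a
  assumes "comm_assoc_algebra scale"
    and "derivation scale d"
    and "scale 2 (\<xi> * \<eta>\<^sub>1) = \<xi> * \<eta>\<^sub>0 + d \<xi>"
  shows "super_gelfand_dorfman_bialgebra (tilde_scale scale) tilde_component
           (tilde_bracket \<xi>) (tilde_circ d \<eta>\<^sub>0 \<eta>\<^sub>1)"
proof -
  interpret derivation scale d by fact
  show ?thesis
    by (intro super_gelfand_dorfman_bialgebra.intro super_gelfand_dorfman_bialgebra_axioms.intro
        lie_superalgebra_tilde novikov_superalgebra_tilde tilde_compatible assms)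
qed

end
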